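(* Let $T$ be an automorphism of a measurable space $(X,\mathcal F)$ and let $\mu_0$ be a $T$-invariant probability measure on $(X,\mathcal F)$. Let $\xi$ be a countable (finite or countably infinite) measurable partition of $(X,\mathcal F)$ with finite entropy $H_{\mu_0}(\xi)<\infty$. Assume that there exist $T$-invariant probability measures $\mu_n$, $n\ge 1$, numbers $r_n\in\mathbb N$, $\varepsilon_n>0$ ($n\ge 0$), and a number $h$ such that $$\lim_{n\to\infty} r_n=\infty,\qquad \lim_{n\to\infty}\varepsilon_n=0,\qquad \limsup_{n\to\infty} h_{\mu_n}(T)\ge h\ge 0,$$ $\xi$ is a generator for $(T,\mu_n)$ for every $n\ge 0$, and $$|\mu_0(A)-\mu_n(A)|\le \varepsilon_n\,\mu_n(A)\quad\text{for every atom } A \text{ of the partition } \bigvee_{i=0}^{r_n}T^{-i}\xi \text{ and every } n\ge 0.$$ Then $h_{\mu_0}(T)\ge h$.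
   Context: $h_\mu(T)$ denotes the Kolmogorov–Sinai entropy of $T$ with respect to a $T$-invariant probability measure $\mu$, and $H_\mu(\eta)=-\sum_{B\in\eta}\mu(B)\ln\mu(B)$ is the entropy of a countable partition $\eta$. A partition $\xi$ is a generator for $(T,\mu)$ if the $\sigma$-algebra generated by the partitions $T^{i}\xi$, $i\in\mathbb Z$, coincides with $\mathcal F$ modulo $\mu$-null sets. $\bigvee_{i=0}^{r}T^{-i}\xi$ is the common refinement of the partitions $\xi, T^{-1}\xi,\dots,T^{-r}\xi$. *)

theory Defs
  imports "HOL-Probability.Probability"
begin

definition meas_partition :: "'a measure \<Rightarrow> 'a set set \<Rightarrow> bool" where
  "meas_partition M \<xi> \<longleftrightarrow> countable \<xi> \<and> \<xi> \<subseteq> sets M \<and> {} \<notin> \<xi>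
      \<and> disjoint \<xi> \<and> \<Union>\<xi> = space M"

text \<open>Entropy of a countable partition:
  H_mu(eta) = - sum_{B in eta} mu(B) ln mu(B), as an extended nonnegative real
  (the terms are nonnegative, so the sum may be +infinity).\<close>
definition part_entropy :: "'a measure \<Rightarrow> 'a set set \<Rightarrow> ennreal" where
  "part_entropy \<mu> \<eta> =
     (\<integral>\<^sup>+ B. ennreal (- measure \<mu> B * ln (measure \<mu> B)) \<partial>count_space \<eta>)"

text \<open>The common refinement of T^{-i} xi for i = 0, ..., n-1
  (for n = 0 this is the trivial partition {space M}).\<close>
definition dyn_refine :: "'a measure \<Rightarrow> ('a \<Rightarrow> 'a) \<Rightarrow> 'a set set \<Rightarrow> nat \<Rightarrow> 'a set set" where
  "dyn_refine M T \<xi> n =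
     {space M \<inter> (\<Inter>i\<in>{..<n}. (T ^^ i) -` f i) | f. \<forall>i<n. f i \<in> \<xi>} - {{}}"

definition ent_rate :: "'a measure \<Rightarrow> ('a \<Rightarrow> 'a) \<Rightarrow> 'a set set \<Rightarrow> real" where
  "ent_rate \<mu> T \<eta> =
     lim (\<lambda>n. enn2real (part_entropy \<mu> (dyn_refine \<mu> T \<eta> n)) / real n)"

definition KS_entropy :: "'a measure \<Rightarrow> ('a \<Rightarrow> 'a) \<Rightarrow> ennreal" where
  "KS_entropy \<mu> T =
     (SUP \<eta> \<in> {\<eta>. meas_partition \<mu> \<eta> \<and> finite \<eta>}. ennreal (ent_rate \<mu> T \<eta>))"

text \<open>The sets T^i C, C in xi, i in Z (T^i C for i >= 0 is the preimage of C
  under the inverse map iterated i times; for i < 0 the preimage under T^(-i)).\<close>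
definition orbit_sets :: "'a measure \<Rightarrow> ('a \<Rightarrow> 'a) \<Rightarrow> 'a set set \<Rightarrow> 'a set set" where
  "orbit_sets M T \<xi> =
     {(T ^^ k) -` C \<inter> space M | k C. C \<in> \<xi>}
     \<union> {(the_inv_into (space M) T ^^ k) -` C \<inter> space M | k C. C \<in> \<xi>}"

definition generator :: "'a measure \<Rightarrow> ('a \<Rightarrow> 'a) \<Rightarrow> 'a set set \<Rightarrow> bool" where
  "generator \<mu> T \<xi> \<longleftrightarrow>
     sigma_sets (space \<mu>) (orbit_sets \<mu> T \<xi>) \<subseteq> sets \<mu> \<and>
     (\<forall>A\<in>sets \<mu>. \<exists>B\<in>sigma_sets (space \<mu>) (orbit_sets \<mu> T \<xi>).
        emeasure \<mu> ((A - B) \<union> (B - A)) = 0)"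

definition automorphism :: "'a measure \<Rightarrow> ('a \<Rightarrow> 'a) \<Rightarrow> bool" where
  "automorphism M T \<longleftrightarrow> T \<in> M \<rightarrow>\<^sub>M M \<and> bij_betw T (space M) (space M)
      \<and> the_inv_into (space M) T \<in> M \<rightarrow>\<^sub>M M"

definition invariant_prob :: "'a measure \<Rightarrow> ('a \<Rightarrow> 'a) \<Rightarrow> 'a measure \<Rightarrow> bool" where
  "invariant_prob M T \<mu> \<longleftrightarrow> prob_space \<mu> \<and> sets \<mu> = sets M
      \<and> (\<forall>A\<in>sets M. emeasure \<mu> (T -` A \<inter> space M) = emeasure \<mu> A)"

end

theory Submission
  imports Defs
begin

text \<open>Let \<open>H m \<mu>\<close> be the entropy of the refinement of \<open>\<xi>\<close> over \<open>m\<close> steps. If \<open>\<xi>\<close> generates for \<open>\<mu> n\<close>,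
  the entropy of \<open>T\<close> is at most \<open>H m (\<mu> n) / m\<close> for each fixed \<open>m\<close>. Once \<open>r n \<ge> m - 1\<close>,
  the bound on relative errors passes from the atoms of the long refinement to those of the short one, and
  \<open>H m (\<mu> n)\<close> is asymptotically at most \<open>H m (\<mu> 0)\<close>. Hence \<open>h \<le> H m (\<mu> 0) / m\<close> for every \<open>m\<close>, and the
  infimum over \<open>m\<close> of the right-hand side is at most the entropy of \<open>T\<close> for \<open>\<mu> 0\<close>.

  Conditional entropy is avoided: in both comparisons a process \<open>X\<close> is written as a function of \<open>Y\<close>
  and a process \<open>Z\<close> of small entropy, and subadditivity bounds the rate of \<open>X\<close> by that of \<open>Y\<close> plus the
  entropy of \<open>Z\<close>. For the generator, \<open>Y\<close> is a finite-window approximation of a finite partition and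
  \<open>Z\<close> records the points where it fails; for countable \<open>\<xi>\<close>, \<open>Y\<close> merges the tail atoms of \<open>\<xi>\<close> and \<open>Z\<close>
  lists them.\<close>

subsection \<open>Entropy of discrete laws\<close>

text \<open>Shannon entropy as the mean of the information \<open>- ln (pmf p x)\<close>. In this
  form comparisons need checking only on the support, and the value may be infinite.\<close>

definition pmf_entropy :: "'b pmf \<Rightarrow> ennreal" where
  "pmf_entropy p = (\<integral>\<^sup>+ x. ennreal (- ln (pmf p x)) \<partial>measure_pmf p)"

lemma pmf_entropy_count_space:
  "pmf_entropy p = (\<integral>\<^sup>+ x. ennreal (- pmf p x * ln (pmf p x)) \<partial>count_space UNIV)"
  unfolding pmf_entropy_def nn_integral_measure_pmf
  by (simp flip: ennreal_mult')

lemma neg_ln_pmf_nonneg: "0 \<le> - ln (pmf p x)"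
  using pmf_le_1[of p x] pmf_nonneg[of p x] by (cases "pmf p x = 0") auto

lemma neg_mult_ln_nonneg: "0 \<le> x \<Longrightarrow> x \<le> 1 \<Longrightarrow> 0 \<le> - x * ln (x::real)"
  by (cases "x = 0") (auto simp: mult_nonneg_nonpos)

text \<open>Since \<open>x\<close> lies in the fibre over \<open>f x\<close>, passing to the image
  can only raise the mass of its atom, so the information drops pointwise on the support.\<close>

lemma pmf_entropy_map_le: "pmf_entropy (map_pmf f p) \<le> pmf_entropy p"
  unfolding pmf_entropy_def nn_integral_map_pmf
proof (intro nn_integral_mono_AE AE_pmfI ennreal_leI)
  fix x assume x: "x \<in> set_pmf p"
  have "pmf p x \<le> pmf (map_pmf f p) (f x)"
    unfolding pmf_map
    by (subst measure_pmf_single[symmetric], rule measure_pmf.finite_measure_mono) auto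
  with pmf_positive[OF x] show "- ln (pmf (map_pmf f p) (f x)) \<le> - ln (pmf p x)"
    by simp
qed

text \<open>Gibbs' inequality for the joint law against the product of its marginals.\<close>
lemma pmf_entropy_subadditive:
  "pmf_entropy p \<le> pmf_entropy (map_pmf fst p) + pmf_entropy (map_pmf snd p)"
proof -
  define p1 where "p1 = map_pmf fst p"
  define p2 where "p2 = map_pmf snd p"
  define q where "q x = pmf (pair_pmf p1 p2) x" for x
  \<comment> \<open>The 1 from \<open>ln t \<le> t - 1\<close> is kept on the left to avoid
    subtraction in \<open>ennreal\<close>; it cancels at the end against the total mass of the
    product law.\<close>
  have "pmf_entropy p + 1 = (\<integral>\<^sup>+ x. ennreal (- ln (pmf p x)) + 1 \<partial>measure_pmf p)"
    unfolding pmf_entropy_def by (simp add: nn_integral_add)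
  also have "\<dots> \<le> (\<integral>\<^sup>+ x. ennreal (- ln (pmf p1 (fst x))) + ennreal (- ln (pmf p2 (snd x)))
                       + ennreal (q x / pmf p x) \<partial>measure_pmf p)"
  proof (intro nn_integral_mono_AE AE_pmfI)
    fix x assume x: "x \<in> set_pmf p"
    have "fst x \<in> set_pmf p1" "snd x \<in> set_pmf p2"
      using x by (auto simp: p1_def p2_def)
    hence pos: "0 < pmf p x" "0 < pmf p1 (fst x)" "0 < pmf p2 (snd x)"
      using x by (auto intro: pmf_positive)
    have qx: "q x = pmf p1 (fst x) * pmf p2 (snd x)"
      unfolding q_def by (cases x) (simp add: pmf_pair)
    have "ln (q x / pmf p x) \<le> q x / pmf p x - 1"
      using pos qx by (intro ln_le_minus_one) auto
    hence "- ln (pmf p x) + 1 \<le> - ln (pmf p1 (fst x)) + - ln (pmf p2 (snd x)) + q x / pmf p x"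
      using pos by (simp add: qx ln_div ln_mult)
    hence "ennreal (- ln (pmf p x) + 1)
        \<le> ennreal (- ln (pmf p1 (fst x)) + - ln (pmf p2 (snd x)) + q x / pmf p x)"
      by (rule ennreal_leI)
    moreover have "0 \<le> q x / pmf p x" by (simp add: q_def)
    ultimately show "ennreal (- ln (pmf p x)) + 1
        \<le> ennreal (- ln (pmf p1 (fst x))) + ennreal (- ln (pmf p2 (snd x))) + ennreal (q x / pmf p x)"
      using neg_ln_pmf_nonneg[of p x] neg_ln_pmf_nonneg[of p1 "fst x"]
        neg_ln_pmf_nonneg[of p2 "snd x"]
      by (simp add: ennreal_plus[symmetric] del: ennreal_plus flip: ennreal_1)
  qed
  also have "\<dots> = pmf_entropy p1 + pmf_entropy p2 + (\<integral>\<^sup>+ x. ennreal (q x / pmf p x) \<partial>measure_pmf p)"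
    by (simp add: nn_integral_add pmf_entropy_def p1_def p2_def)
  \<comment> \<open>Only an inequality, because the left side sees \<open>q\<close> on the support
    of \<open>p\<close> alone.\<close>
  also have "(\<integral>\<^sup>+ x. ennreal (q x / pmf p x) \<partial>measure_pmf p) \<le> (\<integral>\<^sup>+ x. ennreal (q x) \<partial>count_space UNIV)"
    unfolding nn_integral_measure_pmf
    by (intro nn_integral_mono) (auto simp: q_def simp flip: ennreal_mult')
  also have "\<dots> = 1"
    by (simp add: q_def nn_integral_pmf)
  finally show ?thesis
    by (simp add: p1_def p2_def)
qed

lemma neg_mult_ln_le: "0 \<le> x \<Longrightarrow> - x * ln x \<le> 1 - (x::real)"
proof (cases "x = 0")
  case False
  assume "0 \<le> x"
  with False have x: "0 < x" by simp
  have "ln (1 / x) \<le> 1 / x - 1" using x by (intro ln_le_minus_one) auto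
  hence "x * ln (1 / x) \<le> x * (1 / x - 1)" using x by (intro mult_left_mono) auto
  thus ?thesis using x by (simp add: ln_div algebra_simps)
qed simp

text \<open>Apply the previous bound at \<open>sqrt x\<close>, where \<open>ln (sqrt x)\<close> is
  half of \<open>ln x\<close>, and multiply by \<open>2 * sqrt x\<close>.\<close>

lemma neg_mult_ln_le_sqrt: "0 \<le> x \<Longrightarrow> - x * ln x \<le> 2 * sqrt (x::real)"
proof (cases "x = 0")
  case False
  assume "0 \<le> x"
  with False have x: "0 < x" by simp
  have "- sqrt x * ln (sqrt x) \<le> 1 - sqrt x" using x by (intro neg_mult_ln_le) auto
  also have "\<dots> \<le> 1" using x by simp
  finally have "2 * sqrt x * (- sqrt x * ln (sqrt x)) \<le> 2 * sqrt x * 1"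
    using x by (intro mult_left_mono) auto
  moreover have "sqrt x * (sqrt x * ln x) = x * ln x"
    using x by (simp flip: mult.assoc)
  ultimately show ?thesis using x by (simp add: ln_sqrt algebra_simps)
qed simp

text \<open>Meant for laws concentrated near one atom \<open>z\<close>. Both the finite-support
  bound and the tail estimate start from it.\<close>

lemma pmf_entropy_split:
  "pmf_entropy p \<le> ennreal (1 - pmf p z)
     + (\<integral>\<^sup>+ x. ennreal (- pmf p x * ln (pmf p x)) * indicator (- {z}) x \<partial>count_space UNIV)"
proof -
  have "pmf_entropy p = (\<integral>\<^sup>+ x. ennreal (- pmf p z * ln (pmf p z)) * indicator {z} x +
      ennreal (- pmf p x * ln (pmf p x)) * indicator (- {z}) x \<partial>count_space UNIV)"
    unfolding pmf_entropy_count_space by (intro nn_integral_cong) (auto split: split_indicator)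
  also have "\<dots> = ennreal (- pmf p z * ln (pmf p z)) +
      (\<integral>\<^sup>+ x. ennreal (- pmf p x * ln (pmf p x)) * indicator (- {z}) x \<partial>count_space UNIV)"
    by (subst nn_integral_add) (auto simp: nn_integral_cmult_indicator)
  finally show ?thesis
    by (simp only:) (intro add_right_mono ennreal_leI neg_mult_ln_le pmf_nonneg)
qed

text \<open>The estimates \<open>- x ln x \<le> 1 - x\<close> at the atom \<open>z\<close> and \<open>- x ln x \<le> 2 sqrt x\<close>
  elsewhere make the entropy small when \<open>z\<close> carries almost all the mass.\<close>
lemma pmf_entropy_finite_le:
  assumes "finite S" "set_pmf p \<subseteq> insert z S" "1 - pmf p z \<le> d" "d \<le> 1"
  shows "pmf_entropy p \<le> ennreal ((2 * card S + 1) * sqrt d)"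
proof -
  have d: "0 \<le> d" using assms(3) pmf_le_1[of p z] by simp
  have "d \<le> sqrt d" using d assms(4) by (simp add: real_le_rsqrt power2_eq_square mult_left_le)
  have "(\<integral>\<^sup>+ x. ennreal (- pmf p x * ln (pmf p x)) * indicator (- {z}) x \<partial>count_space UNIV)
     \<le> (\<integral>\<^sup>+ x. ennreal (2 * sqrt d) * indicator S x \<partial>count_space UNIV)"
  proof (intro nn_integral_mono)
    fix x :: 'a
    show "ennreal (- pmf p x * ln (pmf p x)) * indicator (- {z}) x \<le> ennreal (2 * sqrt d) * indicator S x"
    proof (cases "x \<noteq> z \<and> x \<in> set_pmf p")
      case True
      \<comment> \<open>Distinct atoms share total mass at most 1, so \<open>x\<close> has at most
        the mass that \<open>z\<close> leaves.\<close>
      have "pmf p x + pmf p z = measure p {x, z}"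
        using True by (simp add: measure_measure_pmf_finite)
      also have "\<dots> \<le> 1" by simp
      finally have "pmf p x \<le> d" using assms(3) by simp
      hence "sqrt (pmf p x) \<le> sqrt d" by simp
      hence "- pmf p x * ln (pmf p x) \<le> 2 * sqrt d"
        using neg_mult_ln_le_sqrt[of "pmf p x"] pmf_nonneg[of p x] by linarith
      moreover have "x \<in> S" using True assms(2) by auto
      ultimately show ?thesis using True by (simp add: ennreal_leI)
    qed (auto simp: set_pmf_iff split: split_indicator)
  qed
  also have "\<dots> = ennreal (2 * sqrt d) * emeasure (count_space UNIV) S"
    by (rule nn_integral_cmult_indicator) simp
  also have "\<dots> = ennreal (2 * card S * sqrt d)"
    using assms(1) d
    by (simp add: emeasure_count_space_finite ennreal_mult' ennreal_mult''
        ennreal_of_nat_eq_real_of_nat mult_ac)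
  finally have "pmf_entropy p \<le> ennreal (1 - pmf p z) + ennreal (2 * card S * sqrt d)"
    using pmf_entropy_split[of p z] by (meson add_left_mono order_trans)
  also have "\<dots> \<le> ennreal (sqrt d) + ennreal (2 * card S * sqrt d)"
    using assms(3) \<open>d \<le> sqrt d\<close> by (intro add_right_mono ennreal_leI) simp
  also have "\<dots> = ennreal ((2 * card S + 1) * sqrt d)"
    using d by (simp add: algebra_simps flip: ennreal_plus)
  finally show ?thesis .
qed

lemma pmf_entropy_finite_support:
  assumes "finite (set_pmf p)"
  shows "pmf_entropy p < \<infinity>"
proof -
  obtain z where "z \<in> set_pmf p" using set_pmf_not_empty[of p] by blast
  show ?thesis
    by (rule le_less_trans[OF pmf_entropy_finite_le[OF assms subset_insertI, of z 1]]) auto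
qed

text \<open>The two comparisons act on different factors of \<open>- q ln q\<close>:
  \<open>p \<le> d q\<close> bounds the logarithm by \<open>- ln p + ln d\<close>, after which
  \<open>q \<le> c p\<close> replaces the weight.\<close>

lemma pmf_entropy_perturb:
  assumes le: "\<And>x. pmf q x \<le> c * pmf p x" and ge: "\<And>x. pmf p x \<le> d * pmf q x"
    and c: "0 \<le> c" and d: "1 \<le> d"
  shows "pmf_entropy q \<le> ennreal c * (pmf_entropy p + ennreal (ln d))"
proof -
  have "pmf_entropy q \<le> (\<integral>\<^sup>+ x. ennreal c * (ennreal (- pmf p x * ln (pmf p x))
           + ennreal (ln d) * ennreal (pmf p x)) \<partial>count_space UNIV)"
    unfolding pmf_entropy_count_space
  proof (intro nn_integral_mono)
    fix x :: 'a
    have "- pmf q x * ln (pmf q x) \<le> c * (- pmf p x * ln (pmf p x) + ln d * pmf p x)"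
    proof (cases "pmf q x = 0")
      case True
      hence "pmf p x = 0" using ge[of x] by (simp add: antisym)
      thus ?thesis using True by simp
    next
      case False
      hence q: "0 < pmf q x" by simp
      hence p: "0 < pmf p x" using le[of x] c by (cases "pmf p x = 0") auto
      have "ln (pmf p x) \<le> ln (d * pmf q x)" using ge[of x] p q d by (subst ln_le_cancel_iff) auto
      also have "\<dots> = ln d + ln (pmf q x)" using q d by (simp add: ln_mult)
      finally have "- ln (pmf q x) \<le> - ln (pmf p x) + ln d" by simp
      hence "pmf q x * - ln (pmf q x) \<le> pmf q x * (- ln (pmf p x) + ln d)"
        using q by (intro mult_left_mono) auto
      also have "\<dots> \<le> (c * pmf p x) * (- ln (pmf p x) + ln d)"
        using le[of x] neg_ln_pmf_nonneg[of p x] d by (intro mult_right_mono add_nonneg_nonneg) auto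
      finally show ?thesis by (simp add: algebra_simps)
    qed
    thus "ennreal (- pmf q x * ln (pmf q x))
        \<le> ennreal c * (ennreal (- pmf p x * ln (pmf p x)) + ennreal (ln d) * ennreal (pmf p x))"
      using c d neg_mult_ln_nonneg[OF pmf_nonneg pmf_le_1, of p x]
      by (simp flip: ennreal_mult' ennreal_plus del: minus_mult_minus mult_minus_left) (rule ennreal_leI)
  qed
  also have "\<dots> = ennreal c * (pmf_entropy p + ennreal (ln d))"
    by (simp add: nn_integral_cmult nn_integral_add pmf_entropy_count_space nn_integral_pmf)
  finally show ?thesis .
qed

text \<open>Domination of atoms sums over the fibres of \<open>f\<close>. With
  \<open>f = take k\<close> it passes from long itineraries to their initial segments.\<close>

lemma pmf_map_le:
  assumes "\<And>x. pmf q x \<le> c * pmf p x" "0 \<le> c"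
  shows "pmf (map_pmf f q) y \<le> c * pmf (map_pmf f p) y"
proof -
  have "emeasure q (f -` {y}) = (\<integral>\<^sup>+ x. ennreal (pmf q x) \<partial>count_space (f -` {y}))"
    by (simp add: nn_integral_pmf)
  also have "\<dots> \<le> (\<integral>\<^sup>+ x. ennreal c * ennreal (pmf p x) \<partial>count_space (f -` {y}))"
    using assms by (intro nn_integral_mono) (simp flip: ennreal_mult' add: ennreal_leI)
  also have "\<dots> = ennreal c * emeasure p (f -` {y})"
    by (simp add: nn_integral_cmult nn_integral_pmf)
  finally show ?thesis
    using assms(2) unfolding pmf_map measure_pmf.emeasure_eq_measure
    by (simp flip: ennreal_mult' add: measure_nonneg)
qed

section \<open>Subadditive sequences\<close>

lemma subadditive_le_linear:
  fixes a :: "nat \<Rightarrow> real"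
  assumes sub: "\<And>n k. a (n + k) \<le> a n + a k" and nn: "\<And>n. 0 \<le> a n" and m: "0 < m"
  shows "a n \<le> (real n / real m) * a m + (\<Sum>s<m. a s)"
proof -
  have mult: "a (q * m + s) \<le> real q * a m + a s" for q s
  proof (induction q)
    case (Suc q)
    have "a (Suc q * m + s) \<le> a m + a (q * m + s)"
      using sub[of m "q * m + s"] by (simp add: add_ac)
    with Suc show ?case by (simp add: algebra_simps)
  qed simp
  \<comment> \<open>The remainder is below \<open>m\<close>, so the sum over \<open>s < m\<close>
    bounds its term independently of \<open>n\<close>.\<close>
  have "a n \<le> real (n div m) * a m + a (n mod m)"
    using mult[of "n div m" "n mod m"] by simp
  also have "real (n div m) * a m \<le> (real n / real m) * a m"
    using nn by (intro mult_right_mono of_nat_div_le_of_nat)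
  also have "a (n mod m) \<le> (\<Sum>s<m. a s)"
    using m nn by (intro member_le_sum) auto
  finally show ?thesis by simp
qed

text \<open>Fekete's lemma: dividing the linear bound by \<open>n\<close> makes the remainder
  constant vanish. The infimum omits \<open>m = 0\<close>, where the quotient would be 0 by
  convention.\<close>

lemma subadditive_rate:
  fixes a :: "nat \<Rightarrow> real"
  assumes sub: "\<And>n k. a (n + k) \<le> a n + a k" and nn: "\<And>n. 0 \<le> a n"
  shows "(\<lambda>n. a n / real n) \<longlonglongrightarrow> (INF m\<in>{0<..}. a m / real m)"
proof -
  define L where "L = (INF m\<in>{0<..}. a m / real m)"
  have bdd: "bdd_below ((\<lambda>m. a m / real m) ` {0<..})"
    using nn by (intro bdd_belowI[of _ 0]) auto
  have low: "L \<le> a n / real n" if "0 < n" for n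
    unfolding L_def using that bdd by (intro cINF_lower) auto
  have "(\<lambda>n. a n / real n) \<longlonglongrightarrow> L"
  proof (rule order_tendstoI)
    fix y assume "y < L"
    thus "\<forall>\<^sub>F n in sequentially. y < a n / real n"
      using low by (intro eventually_mono[OF eventually_gt_at_top[of 0]]) (meson less_le_trans)
  next
    fix y assume "L < y"
    then obtain m where m: "0 < m" "a m / real m < y"
      unfolding L_def using bdd by (subst (asm) cINF_less_iff) auto
    define C where "C = (\<Sum>s<m. a s)"
    have "(\<lambda>n. a m / real m + C / real n) \<longlonglongrightarrow> a m / real m + 0"
      by (intro tendsto_intros lim_const_over_n)
    hence "\<forall>\<^sub>F n in sequentially. a m / real m + C / real n < y"
      using m by (intro order_tendstoD(2)) auto
    thus "\<forall>\<^sub>F n in sequentially. a n / real n < y"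
      using eventually_gt_at_top[of 0]
    proof eventually_elim
      case (elim n)
      have "a n / real n \<le> ((real n / real m) * a m + C) / real n"
        unfolding C_def by (intro divide_right_mono subadditive_le_linear sub nn m) auto
      also have "\<dots> = a m / real m + C / real n" using elim by (simp add: field_simps)
      finally show ?case using elim by simp
    qed
  qed
  thus ?thesis by (simp add: L_def)
qed

section \<open>Laws and entropy of countably valued random variables\<close>

definition law :: "'a measure \<Rightarrow> ('a \<Rightarrow> 'b) \<Rightarrow> 'b pmf" where
  "law M X = Abs_pmf (distr M (count_space UNIV) X)"

abbreviation ent :: "'a measure \<Rightarrow> ('a \<Rightarrow> 'b) \<Rightarrow> ennreal" where
  "ent M X \<equiv> pmf_entropy (law M X)"

abbreviation rv :: "'a measure \<Rightarrow> ('a \<Rightarrow> 'b) \<Rightarrow> bool" where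
  "rv M X \<equiv> X \<in> M \<rightarrow>\<^sub>M count_space UNIV"

lemma law_cong: "(\<And>x. x \<in> space M \<Longrightarrow> X x = Y x) \<Longrightarrow> law M X = law M Y"
  unfolding law_def by (intro arg_cong[of _ _ Abs_pmf] distr_cong) auto

lemma rv_compose2:
  fixes X :: "'a \<Rightarrow> 'b::countable" and Y :: "'a \<Rightarrow> 'c::countable"
  assumes [measurable]: "rv M X" "rv M Y"
  shows "rv M (\<lambda>x. f (X x) (Y x))"
  by (rule measurable_compose_countable[where g = X], rule measurable_compose_countable[where g = Y])
     (use assms in auto)

context prob_space
begin

lemma measure_pmf_law:
  fixes X :: "'a \<Rightarrow> 'b::countable"
  assumes X [measurable]: "rv M X"
  shows "measure_pmf (law M X) = distr M (count_space UNIV) X"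
proof -
  let ?D = "distr M (count_space UNIV) X"
  interpret D: prob_space ?D by (rule prob_space_distr) fact
  \<comment> \<open>The value type is countable, so the null singletons together are null; almost
    every value is then an atom, as the inverse of \<open>Abs_pmf\<close> requires.\<close>
  have "(\<Union>v\<in>{v. measure ?D {v} = 0}. {v}) \<in> null_sets ?D"
    by (intro null_sets_UN') (auto simp: null_sets_def D.emeasure_eq_measure)
  hence "AE v in ?D. measure ?D {v} \<noteq> 0"
    by (rule AE_I') auto
  thus ?thesis
    unfolding law_def by (intro Abs_pmf_inverse) (auto intro: D.prob_space_axioms)
qed

lemma pmf_law:
  fixes X :: "'a \<Rightarrow> 'b::countable"
  assumes "rv M X"
  shows "pmf (law M X) v = measure M (X -` {v} \<inter> space M)"
  using assms by (simp add: pmf.rep_eq measure_pmf_law measure_distr)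

lemma map_pmf_law:
  fixes X :: "'a \<Rightarrow> 'b::countable" and f :: "'b \<Rightarrow> 'c::countable"
  assumes [measurable]: "rv M X"
  shows "map_pmf f (law M X) = law M (\<lambda>x. f (X x))"
proof -
  have "measure_pmf (map_pmf f (law M X)) = measure_pmf (law M (\<lambda>x. f (X x)))"
    unfolding map_pmf_rep_eq by (subst (1 2) measure_pmf_law) (auto simp: distr_distr comp_def)
  thus ?thesis by (simp add: measure_pmf_inject)
qed

lemma set_pmf_law:
  fixes X :: "'a \<Rightarrow> 'b::countable"
  assumes "rv M X"
  shows "set_pmf (law M X) \<subseteq> X ` space M"
proof
  fix v assume "v \<in> set_pmf (law M X)"
  hence "X -` {v} \<inter> space M \<noteq> {}" by (auto simp: set_pmf_iff pmf_law[OF assms])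
  thus "v \<in> X ` space M" by auto
qed

text \<open>The second assumption says that \<open>Y\<close> factors through \<open>X\<close> on the
  space; the factor map \<open>g\<close> comes from choosing a point over each value, so
  applications need not exhibit it.\<close>

lemma ent_mono:
  fixes X :: "'a \<Rightarrow> 'b::countable" and Y :: "'a \<Rightarrow> 'c::countable"
  assumes "rv M X" and "\<And>x y. x \<in> space M \<Longrightarrow> y \<in> space M \<Longrightarrow> X x = X y \<Longrightarrow> Y x = Y y"
  shows "ent M Y \<le> ent M X"
proof -
  define g where "g v = Y (SOME x. x \<in> space M \<and> X x = v)" for v
  have "g (X x) = Y x" if "x \<in> space M" for x
    unfolding g_def using that assms(2)[OF _ that]
    by (metis (mono_tags, lifting) someI_ex)
  hence "law M Y = map_pmf g (law M X)"
    using assms(1) by (auto simp: map_pmf_law intro: law_cong)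
  thus ?thesis by (simp add: pmf_entropy_map_le)
qed

lemma ent_Pair_le:
  fixes X :: "'a \<Rightarrow> 'b::countable" and Y :: "'a \<Rightarrow> 'c::countable"
  assumes "rv M X" "rv M Y"
  shows "ent M (\<lambda>x. (X x, Y x)) \<le> ent M X + ent M Y"
  using pmf_entropy_subadditive[of "law M (\<lambda>x. (X x, Y x))"] assms
  by (simp add: map_pmf_law rv_compose2[where f = Pair])

lemma ent_finite_range:
  fixes X :: "'a \<Rightarrow> 'b::countable"
  assumes "rv M X" "finite (X ` space M)"
  shows "ent M X < \<infinity>"
  using assms by (intro pmf_entropy_finite_support finite_subset[OF set_pmf_law])

end

subsection \<open>Itineraries\<close>

text \<open>Coding by lists keeps the value type countable. The times \<open>0, ..., n - 1\<close>
  match those of \<open>dyn_refine\<close>.\<close>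

definition itin :: "('a \<Rightarrow> 'a) \<Rightarrow> ('a \<Rightarrow> 'b) \<Rightarrow> nat \<Rightarrow> 'a \<Rightarrow> 'b list" where
  "itin T X n x = map (\<lambda>i. X ((T ^^ i) x)) [0..<n]"

lemma itin_eq_iff: "itin T X n x = itin T X n y \<longleftrightarrow> (\<forall>i<n. X ((T ^^ i) x) = X ((T ^^ i) y))"
  by (auto simp: itin_def)

lemma take_itin: "k \<le> n \<Longrightarrow> take k (itin T X n x) = itin T X k x"
  by (simp add: itin_def take_map)

locale stationary = prob_space M for M :: "'a measure" +
  fixes T :: "'a \<Rightarrow> 'a"
  assumes T_meas [measurable]: "T \<in> M \<rightarrow>\<^sub>M M"
    and T_inv: "distr M M T = M"
begin

lemma T_funpow [measurable]: "(T ^^ k) \<in> M \<rightarrow>\<^sub>M M"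
proof (induction k)
  case (Suc k)
  thus ?case by (simp add: measurable_comp[OF _ T_meas])
qed (simp add: id_def)

lemma T_funpow_space: "x \<in> space M \<Longrightarrow> (T ^^ k) x \<in> space M"
  using T_funpow by (rule measurable_space)

lemma distr_funpow: "distr M M (T ^^ k) = M"
proof (induction k)
  case 0
  show ?case by (simp add: id_def distr_id)
next
  case (Suc k)
  have "distr M M (T ^^ Suc k) = distr (distr M M (T ^^ k)) M T"
    by (simp add: distr_distr)
  thus ?case by (simp only: Suc.IH T_inv)
qed

lemma law_shift:
  fixes X :: "'a \<Rightarrow> 'b::countable"
  assumes [measurable]: "rv M X"
  shows "law M (\<lambda>x. X ((T ^^ k) x)) = law M X"
proof -
  have "distr M (count_space UNIV) (\<lambda>x. X ((T ^^ k) x)) = distr (distr M M (T ^^ k)) (count_space UNIV) X"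
    by (subst distr_distr) (auto simp: comp_def)
  thus ?thesis by (simp add: law_def distr_funpow)
qed

lemma rv_itin [measurable]:
  fixes X :: "'a \<Rightarrow> 'b::countable"
  assumes [measurable]: "rv M X"
  shows "rv M (itin T X n)"
proof (induction n)
  case (Suc n)
  have "rv M (\<lambda>x. itin T X n x @ [X ((T ^^ n) x)])"
    by (intro rv_compose2[where f = "\<lambda>u v. u @ [v]"] Suc) measurable
  thus ?case by (simp add: itin_def)
qed (simp add: itin_def)

text \<open>Cut the itinerary at time \<open>n\<close>: by stationarity the second block has the law
  of an itinerary of length \<open>k\<close>.\<close>

lemma ent_itin_add:
  fixes X :: "'a \<Rightarrow> 'b::countable"
  assumes [measurable]: "rv M X"
  shows "ent M (itin T X (n + k)) \<le> ent M (itin T X n) + ent M (itin T X k)"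
proof -
  have "ent M (itin T X (n + k)) \<le> ent M (\<lambda>x. (itin T X n x, itin T X k ((T ^^ n) x)))"
  proof (rule ent_mono)
    show "rv M (\<lambda>x. (itin T X n x, itin T X k ((T ^^ n) x)))"
      by (rule rv_compose2[where f = Pair]) measurable
    fix x y assume *: "(itin T X n x, itin T X k ((T ^^ n) x)) = (itin T X n y, itin T X k ((T ^^ n) y))"
    have "[0..<n + k] = [0..<n] @ map (\<lambda>i. i + n) [0..<k]"
      using upt_add_eq_append[of 0 n k] by (simp add: map_add_upt add.commute[of n k])
    hence "itin T X (n + k) z = itin T X n z @ itin T X k ((T ^^ n) z)" for z
      by (simp add: itin_def funpow_add del: map_add_upt)
    with * show "itin T X (n + k) x = itin T X (n + k) y" by simp
  qed
  also have "\<dots> \<le> ent M (itin T X n) + ent M (\<lambda>x. itin T X k ((T ^^ n) x))"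
    by (rule ent_Pair_le) measurable
  also have "ent M (\<lambda>x. itin T X k ((T ^^ n) x)) = ent M (itin T X k)"
    by (subst law_shift) measurable
  finally show ?thesis .
qed

lemma ent_itin_le:
  fixes X :: "'a \<Rightarrow> 'b::countable"
  assumes [measurable]: "rv M X"
  shows "ent M (itin T X n) \<le> of_nat n * ent M X"
proof (induction n)
  case 0
  \<comment> \<open>The empty itinerary is constant, and a \<open>unit\<close>-valued variable has
    entropy 0 by the finite bound with \<open>d = 0\<close>.\<close>
  have "ent M (itin T X 0) \<le> ent M (\<lambda>_. ())"
    by (rule ent_mono) (auto simp: itin_def)
  also have "\<dots> \<le> 0"
    using pmf_entropy_finite_le[of "{}" "law M (\<lambda>_. ())" "()" 0]
    by (simp add: pmf_law prob_space subset_iff)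
  finally show ?case by simp
next
  case (Suc n)
  have "ent M (itin T X 1) \<le> ent M X"
    by (rule ent_mono) (auto simp: itin_def)
  with ent_itin_add[OF assms, of 1 n] Suc
  have "ent M (itin T X (Suc n)) \<le> ent M X + of_nat n * ent M X"
    by (simp add: add_mono order_trans)
  thus ?case by (simp add: algebra_simps)
qed

lemma ent_itin_finite:
  fixes X :: "'a \<Rightarrow> 'b::countable"
  assumes "rv M X" "ent M X < \<infinity>"
  shows "ent M (itin T X n) < \<infinity>"
  using le_less_trans[OF ent_itin_le[OF assms(1), of n]] assms(2)
  by (simp add: ennreal_mult_less_top ennreal_of_nat_eq_real_of_nat)

text \<open>Stands in for conditional entropy: \<open>Z\<close> carries what \<open>Y\<close> misses
  of \<open>X\<close>, and costs at most its one-step entropy at each time.\<close>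

lemma ent_itin_function_le:
  fixes X :: "'a \<Rightarrow> 'b::countable" and Y :: "'a \<Rightarrow> 'c::countable" and Z :: "'a \<Rightarrow> 'd::countable"
  assumes [measurable]: "rv M Y" "rv M Z"
    and X: "\<And>x. x \<in> space M \<Longrightarrow> X x = g (Y x) (Z x)"
  shows "ent M (itin T X n) \<le> ent M (itin T Y n) + of_nat n * ent M Z"
proof -
  have "ent M (itin T X n) \<le> ent M (\<lambda>x. (itin T Y n x, itin T Z n x))"
  proof (rule ent_mono)
    show "rv M (\<lambda>x. (itin T Y n x, itin T Z n x))"
      by (rule rv_compose2[where f = Pair]) measurable
  qed (auto simp: itin_eq_iff X T_funpow_space)
  also have "\<dots> \<le> ent M (itin T Y n) + ent M (itin T Z n)"
    by (rule ent_Pair_le) measurable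
  also have "\<dots> \<le> ent M (itin T Y n) + of_nat n * ent M Z"
    by (intro add_left_mono ent_itin_le) measurable
  finally show ?thesis .
qed

end

subsection \<open>Partitions as fibres\<close>

text \<open>Indexing by attained values keeps the empty set out, as \<open>meas_partition\<close>
  demands.\<close>

definition fibers :: "'a measure \<Rightarrow> ('a \<Rightarrow> 'b) \<Rightarrow> 'a set set" where
  "fibers M X = (\<lambda>v. X -` {v} \<inter> space M) ` (X ` space M)"

lemma inj_on_fibers: "inj_on (\<lambda>v. X -` {v} \<inter> space M) (X ` space M)"
  by (auto simp: inj_on_def)

lemma (in prob_space) part_entropy_fibers:
  fixes X :: "'a \<Rightarrow> 'b::countable"
  assumes "rv M X"
  shows "part_entropy M (fibers M X) = ent M X"
proof -
  have "part_entropy M (fibers M X) =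
      (\<integral>\<^sup>+ v. ennreal (- pmf (law M X) v * ln (pmf (law M X) v)) \<partial>count_space (X ` space M))"
    unfolding part_entropy_def pmf_law[OF assms]
    by (rule nn_integral_bij_count_space[symmetric])
       (auto simp: bij_betw_def inj_on_fibers fibers_def)
  also have "\<dots> = ent M X"
  proof -
    have 0: "pmf (law M X) v = 0" if "v \<notin> X ` space M" for v
      using that set_pmf_law[OF assms] by (meson pmf_eq_0_set_pmf subsetD)
    show ?thesis
      unfolding pmf_entropy_count_space
      by (subst nn_integral_count_space_indicator) (auto simp: 0 intro!: nn_integral_cong split: split_indicator)
  qed
  finally show ?thesis .
qed

lemma meas_partition_fibers:
  fixes X :: "'a \<Rightarrow> 'b::countable"
  assumes "rv M X"
  shows "meas_partition M (fibers M X)"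
  unfolding meas_partition_def fibers_def disjoint_def
  using measurable_sets[OF assms] by (auto simp: countable_subset)

text \<open>Numbering the cells by \<open>to_nat_on\<close> turns a countable partition into level
  sets of a variable, to which the results on discrete laws apply.\<close>

lemma meas_partition_obtain_fibers:
  assumes \<xi>: "meas_partition M \<xi>"
  obtains X :: "'a \<Rightarrow> nat" where "rv M X" "fibers M X = \<xi>"
proof -
  define X where "X x = to_nat_on \<xi> (THE C. C \<in> \<xi> \<and> x \<in> C)" for x
  from \<xi> have cnt: "countable \<xi>" and sts: "\<xi> \<subseteq> sets M" and ne: "{} \<notin> \<xi>"
    and dis: "disjoint \<xi>" and un: "\<Union>\<xi> = space M"
    unfolding meas_partition_def by auto
  have X: "X x = to_nat_on \<xi> C" if "C \<in> \<xi>" "x \<in> C" for x C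
  proof -
    have "(THE C. C \<in> \<xi> \<and> x \<in> C) = C"
      using that dis by (intro the_equality) (auto simp: disjoint_def)
    thus ?thesis by (simp add: X_def)
  qed
  have fib: "X -` {to_nat_on \<xi> C} \<inter> space M = C" if "C \<in> \<xi>" for C
  proof -
    have "x \<in> C" if "x \<in> space M" "X x = to_nat_on \<xi> C" for x
    proof -
      from that un obtain D where D: "D \<in> \<xi>" "x \<in> D" by auto
      hence "to_nat_on \<xi> D = to_nat_on \<xi> C" using X that by metis
      thus ?thesis using D \<open>C \<in> \<xi>\<close> cnt by simp
    qed
    thus ?thesis using that X un by auto
  qed
  have ran: "X ` space M = to_nat_on \<xi> ` \<xi>"
  proof (intro equalityI subsetI)
    fix v assume "v \<in> X ` space M"
    then obtain x where x: "x \<in> space M" "v = X x" by blast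
    then obtain C where "C \<in> \<xi>" "x \<in> C" using un by blast
    thus "v \<in> to_nat_on \<xi> ` \<xi>" using X x by blast
  next
    fix v assume "v \<in> to_nat_on \<xi> ` \<xi>"
    then obtain C where C: "C \<in> \<xi>" "v = to_nat_on \<xi> C" by blast
    then obtain x where x: "x \<in> C" using ne by (metis ex_in_conv)
    hence "x \<in> space M" using C un by blast
    thus "v \<in> X ` space M" using X[OF C(1) x] C(2) by (metis image_eqI)
  qed
  have "rv M X"
  proof (rule measurable_count_space_eq2_countable[THEN iffD2], intro conjI ballI)
    fix v
    show "X -` {v} \<inter> space M \<in> sets M"
    proof (cases "v \<in> X ` space M")
      case True
      thus ?thesis using ran fib sts by auto
    next
      case False
      hence "X -` {v} \<inter> space M = {}" by auto
      thus ?thesis by simp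
    qed
  qed auto
  moreover have "fibers M X = \<xi>"
    unfolding fibers_def ran by (simp add: image_image fib cong: image_cong)
  ultimately show thesis by (rule that)
qed

lemma finite_fibers_iff: "finite (fibers M X) \<longleftrightarrow> finite (X ` space M)"
  unfolding fibers_def by (rule finite_image_iff[OF inj_on_fibers])

text \<open>Links the partition form of the theorem to itineraries; discarding the empty set
  corresponds to keeping only attained itineraries.\<close>

lemma dyn_refine_fibers:
  assumes T: "T \<in> space M \<rightarrow> space M"
  shows "dyn_refine M T (fibers M X) n = fibers M (itin T X n)"
proof -
  have sp: "(T ^^ i) x \<in> space M" if "x \<in> space M" for i x
    using T that by (induction i) auto
  have fib: "space M \<inter> (\<Inter>i\<in>{..<n}. (T ^^ i) -` (X -` {X ((T ^^ i) x)} \<inter> space M))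
      = itin T X n -` {itin T X n x} \<inter> space M" for x
    using sp by (auto simp: itin_eq_iff)
  show ?thesis
  proof (intro equalityI subsetI)
    fix D assume "D \<in> dyn_refine M T (fibers M X) n"
    then obtain f where D: "D = space M \<inter> (\<Inter>i\<in>{..<n}. (T ^^ i) -` f i)"
      and f: "\<forall>i<n. f i \<in> fibers M X" and ne: "D \<noteq> {}"
      unfolding dyn_refine_def by (elim DiffE CollectE exE conjE) simp
    \<comment> \<open>One point of the cell determines every \<open>f i\<close> with
      \<open>i < n\<close>: it is the fibre through the \<open>i\<close>-th iterate.\<close>
    from ne obtain x where x: "x \<in> D" by blast
    have "f i = X -` {X ((T ^^ i) x)} \<inter> space M" if "i < n" for i
    proof -
      have "f i \<in> fibers M X" using f that by simp
      then obtain v where v: "f i = X -` {v} \<inter> space M"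
        unfolding fibers_def by (elim imageE) simp
      moreover have "(T ^^ i) x \<in> f i" using x that unfolding D by blast
      ultimately have "v = X ((T ^^ i) x)" by simp
      with v show ?thesis by simp
    qed
    hence "D = space M \<inter> (\<Inter>i\<in>{..<n}. (T ^^ i) -` (X -` {X ((T ^^ i) x)} \<inter> space M))"
      unfolding D by auto
    hence "D = itin T X n -` {itin T X n x} \<inter> space M" by (simp only: fib)
    moreover have "x \<in> space M" using x unfolding D by blast
    ultimately show "D \<in> fibers M (itin T X n)" unfolding fibers_def by blast
  next
    fix D assume "D \<in> fibers M (itin T X n)"
    then obtain x where x: "x \<in> space M" and D: "D = itin T X n -` {itin T X n x} \<inter> space M"
      unfolding fibers_def by auto
    have "\<forall>i<n. X -` {X ((T ^^ i) x)} \<inter> space M \<in> fibers M X"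
      using sp[OF x] by (simp add: fibers_def)
    hence "D \<in> {space M \<inter> (\<Inter>i\<in>{..<n}. (T ^^ i) -` f i) | f. \<forall>i<n. f i \<in> fibers M X}"
      unfolding D fib[symmetric]
      by (intro CollectI exI[of _ "\<lambda>i. X -` {X ((T ^^ i) x)} \<inter> space M"] conjI refl)
    moreover have "D \<noteq> {}" using x D by auto
    ultimately show "D \<in> dyn_refine M T (fibers M X) n"
      unfolding dyn_refine_def by auto
  qed
qed

context stationary
begin

text \<open>\<open>ent_rate\<close> is a bare \<open>lim\<close>, so convergence must be proved;
  Fekete's lemma gives it, finiteness making \<open>enn2real\<close> additive.\<close>

lemma ent_rate_fibers:
  fixes X :: "'a \<Rightarrow> 'b::countable"
  assumes [measurable]: "rv M X" and fin: "ent M X < \<infinity>"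
  shows "(\<lambda>n. enn2real (ent M (itin T X n)) / real n) \<longlonglongrightarrow> ent_rate M T (fibers M X)"
proof -
  let ?a = "\<lambda>n. enn2real (ent M (itin T X n))"
  note fin' = ent_itin_finite[OF assms]
  have lim: "(\<lambda>n. ?a n / real n) \<longlonglongrightarrow> (INF m\<in>{0<..}. ?a m / real m)"
  proof (rule subadditive_rate)
    fix n k
    have "?a (n + k) \<le> enn2real (ent M (itin T X n) + ent M (itin T X k))"
      using fin' by (intro enn2real_mono ent_itin_add) auto
    also have "\<dots> = ?a n + ?a k"
      using fin' by (intro enn2real_plus) auto
    finally show "?a (n + k) \<le> ?a n + ?a k" .
  qed auto
  have T: "T \<in> space M \<rightarrow> space M" using measurable_space[OF T_meas] by auto
  have "ent_rate M T (fibers M X) = lim (\<lambda>n. ?a n / real n)"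
    unfolding ent_rate_def dyn_refine_fibers[OF T] by (subst part_entropy_fibers) auto
  with lim show ?thesis by (simp add: limI)
qed

end

section \<open>Truncation of countable partitions\<close>

text \<open>The merged atom contributes at most the tail mass, and the other atoms form a tail of
  the convergent entropy series.\<close>

lemma pmf_entropy_tail:
  fixes p :: "nat pmf"
  assumes fin: "pmf_entropy p < \<infinity>"
  shows "(\<lambda>k. pmf_entropy (map_pmf (\<lambda>v. if v \<le> k then 0 else v) p)) \<longlonglongrightarrow> 0"
proof (rule tendsto_sandwich[OF _ _ tendsto_const])
  \<comment> \<open>Mass and entropy term are added so that one dominated convergence handles both
    tails; the total is \<open>1 + pmf_entropy p\<close>.\<close>
  define g where "g v = ennreal (pmf p v) + ennreal (- pmf p v * ln (pmf p v))" for v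
  have "(\<lambda>k. \<integral>\<^sup>+ v. g v * indicator {k<..} v \<partial>count_space UNIV) \<longlonglongrightarrow> (\<integral>\<^sup>+ v. 0 \<partial>count_space (UNIV :: nat set))"
  proof (rule nn_integral_dominated_convergence[where w = g])
    have "(\<integral>\<^sup>+ v. g v \<partial>count_space UNIV) = 1 + pmf_entropy p"
      unfolding g_def pmf_entropy_count_space by (subst nn_integral_add) (auto simp: nn_integral_pmf)
    thus "(\<integral>\<^sup>+ v. g v \<partial>count_space UNIV) < \<infinity>" using fin by simp
    show "AE v in count_space UNIV. (\<lambda>k. g v * indicator {k<..} v) \<longlonglongrightarrow> 0"
    proof (intro AE_I2 tendsto_eventually)
      fix v :: nat
      show "\<forall>\<^sub>F k in sequentially. g v * indicator {k<..} v = 0"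
        by (rule eventually_sequentiallyI[of v]) auto
    qed
  qed (auto split: split_indicator)
  thus "(\<lambda>k. \<integral>\<^sup>+ v. g v * indicator {k<..} v \<partial>count_space UNIV) \<longlonglongrightarrow> 0" by simp
  show "\<forall>\<^sub>F k in sequentially. pmf_entropy (map_pmf (\<lambda>v. if v \<le> k then 0 else v) p)
      \<le> (\<integral>\<^sup>+ v. g v * indicator {k<..} v \<partial>count_space UNIV)"
  proof (intro always_eventually allI)
    fix k
    let ?f = "\<lambda>v::nat. if v \<le> k then 0 else v"
    have vim: "?f -` {v} = (if v = 0 then {..k} else if v \<le> k then {} else {v})" for v
      by (auto split: if_splits)
    have pv: "pmf (map_pmf ?f p) v = (if v \<le> k then 0 else pmf p v)" if "v \<noteq> 0" for v
      using that unfolding pmf_map vim by (auto simp: measure_pmf_single)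
    have p0: "1 - pmf (map_pmf ?f p) 0 = measure p {k<..}"
      unfolding pmf_map vim using measure_pmf.prob_compl[of "{..k}" p]
      by (simp add: Compl_eq_Diff_UNIV[symmetric])
    have "pmf_entropy (map_pmf ?f p) \<le> emeasure p {k<..} +
        (\<integral>\<^sup>+ v. ennreal (- pmf p v * ln (pmf p v)) * indicator {k<..} v \<partial>count_space UNIV)"
      unfolding measure_pmf.emeasure_eq_measure
    proof (rule order_trans[OF pmf_entropy_split[of _ 0]], rule add_mono)
      show "ennreal (1 - pmf (map_pmf ?f p) 0) \<le> ennreal (measure p {k<..})"
        by (simp only: p0)
    qed (auto intro!: nn_integral_mono simp: pv split: split_indicator)
    also have "\<dots> = (\<integral>\<^sup>+ v. g v * indicator {k<..} v \<partial>count_space UNIV)"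
      unfolding nn_integral_pmf[symmetric]
      by (subst nn_integral_count_space_indicator)
         (auto simp: g_def distrib_right nn_integral_add[symmetric])
    finally show "pmf_entropy (map_pmf ?f p) \<le> \<dots>" .
  qed
qed auto

context stationary
begin

lemma ent_rate_le_KS_entropy:
  fixes X :: "'a \<Rightarrow> 'b::countable"
  assumes "rv M X" "finite (X ` space M)"
  shows "ennreal (ent_rate M T (fibers M X)) \<le> KS_entropy M T"
  unfolding KS_entropy_def using assms
  by (intro SUP_upper) (simp add: meas_partition_fibers finite_fibers_iff)

text \<open>\<open>KS_entropy\<close> ranges over finite partitions, while \<open>X\<close> may take
  infinitely many values. A truncation of \<open>X\<close> loses at most \<open>e\<close> of the
  rate, for arbitrary \<open>e\<close>.\<close>

lemma ent_itin_rate_le_KS_entropy: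
  fixes X :: "'a \<Rightarrow> nat"
  assumes X [measurable]: "rv M X" and fin: "ent M X < \<infinity>"
    and c: "\<And>n. 0 < n \<Longrightarrow> c \<le> enn2real (ent M (itin T X n)) / real n"
  shows "ennreal c \<le> KS_entropy M T"
proof (rule ennreal_le_epsilon)
  fix e :: real
  assume e: "0 < e"
  have "\<forall>\<^sub>F k in sequentially. pmf_entropy (map_pmf (\<lambda>v. if v \<le> k then 0 else v) (law M X)) < ennreal e"
    using e by (intro order_tendstoD(2)[OF pmf_entropy_tail] fin) simp
  then obtain k where k: "pmf_entropy (map_pmf (\<lambda>v. if v \<le> k then 0 else v) (law M X)) < ennreal e"
    by (auto simp: eventually_sequentially)
  \<comment> \<open>\<open>Y\<close> lumps the values above \<open>k\<close>, and \<open>Z\<close>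
    lists them. A nonzero \<open>Z\<close> is the value of \<open>X\<close> itself;
    \<open>Z = 0\<close> means \<open>X x \<le> k\<close>, where \<open>Y\<close> equals
    \<open>X\<close>.\<close>
  define Y where "Y x = min (X x) (Suc k)" for x
  define Z where "Z x = (if X x \<le> k then 0 else X x)" for x
  have Y [measurable]: "rv M Y" unfolding Y_def by measurable
  have Z [measurable]: "rv M Z" unfolding Z_def by measurable
  have entZ: "ent M Z \<le> ennreal e"
    using k unfolding map_pmf_law[OF X] Z_def by simp
  have fY: "finite (Y ` space M)"
    by (rule finite_subset[of _ "{..Suc k}"]) (auto simp: Y_def)
  have entY: "ent M Y < \<infinity>" by (rule ent_finite_range) fact+
  have "c - e \<le> enn2real (ent M (itin T Y n)) / real n" if n: "0 < n" for n
  proof -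
    have "ent M (itin T X n) \<le> ent M (itin T Y n) + of_nat n * ent M Z"
      by (rule ent_itin_function_le[where g = "\<lambda>y z. if z = 0 then y else z"])
         (auto simp: Y_def Z_def Y[unfolded Y_def] Z[unfolded Z_def])
    also have "\<dots> \<le> ent M (itin T Y n) + of_nat n * ennreal e"
      by (intro add_left_mono mult_left_mono entZ) auto
    also have "\<dots> = ennreal (enn2real (ent M (itin T Y n)) + real n * e)"
      using e ent_itin_finite[OF Y entY, of n]
      by (simp add: ennreal_of_nat_eq_real_of_nat ennreal_mult')
    finally have "enn2real (ent M (itin T X n)) \<le> enn2real (ent M (itin T Y n)) + real n * e"
      using e by (intro enn2real_leI) auto
    with c[OF n] n show ?thesis by (simp add: field_simps)
  qed
  hence "c - e \<le> ent_rate M T (fibers M Y)"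
    by (intro LIMSEQ_le_const[OF ent_rate_fibers[OF Y entY]]) (auto intro!: exI[of _ 1])
  hence "ennreal c \<le> ennreal (ent_rate M T (fibers M Y) + e)"
    by (intro ennreal_leI) simp
  also have "\<dots> \<le> ennreal (ent_rate M T (fibers M Y)) + ennreal e"
    using e by (cases "0 \<le> ent_rate M T (fibers M Y)")
       (auto simp: ennreal_neg intro!: ennreal_leI)
  also have "\<dots> \<le> KS_entropy M T + ennreal e"
    by (intro add_right_mono ent_rate_le_KS_entropy Y fY)
  finally show "ennreal c \<le> KS_entropy M T + ennreal e" .
qed

end

subsection \<open>Generators\<close>

locale stationary_automorphism = stationary +
  assumes aut: "automorphism M T"
begin

definition S :: "'a \<Rightarrow> 'a" where "S = the_inv_into (space M) T"

lemma bij_T: "bij_betw T (space M) (space M)"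
  and S_meas [measurable]: "S \<in> M \<rightarrow>\<^sub>M M"
  using aut by (auto simp: automorphism_def S_def)

lemma S_T: "x \<in> space M \<Longrightarrow> S (T x) = x"
  using bij_T unfolding S_def by (simp add: the_inv_into_f_f bij_betw_def)

lemma S_funpow [measurable]: "(S ^^ k) \<in> M \<rightarrow>\<^sub>M M"
proof (induction k)
  case (Suc k)
  thus ?case by (simp add: measurable_comp[OF _ S_meas])
qed (simp add: id_def)

lemma S_funpow_T_funpow: "x \<in> space M \<Longrightarrow> (S ^^ k) ((T ^^ (k + j)) x) = (T ^^ j) x"
proof (induction k arbitrary: j)
  case (Suc k)
  have "(S ^^ Suc k) ((T ^^ (Suc k + j)) x) = S ((S ^^ k) ((T ^^ (k + Suc j)) x))"
    by simp
  also have "\<dots> = (T ^^ j) x"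
    by (simp only: Suc) (simp add: S_T T_funpow_space Suc.prems)
  finally show ?case .
qed simp

definition agree :: "('a \<Rightarrow> 'b) \<Rightarrow> nat \<Rightarrow> 'a \<Rightarrow> 'a \<Rightarrow> bool" where
  "agree X N x y \<longleftrightarrow>
     (\<forall>k\<le>N. X ((T ^^ k) x) = X ((T ^^ k) y) \<and> X ((S ^^ k) x) = X ((S ^^ k) y))"

text \<open>Sets depending only on the two-sided itinerary over times \<open>-N, ..., N\<close>.\<close>
definition window_set :: "('a \<Rightarrow> 'b) \<Rightarrow> nat \<Rightarrow> 'a set \<Rightarrow> bool" where
  "window_set X N B \<longleftrightarrow> B \<in> sets M \<and>
     (\<forall>x\<in>space M. \<forall>y\<in>space M. agree X N x y \<longrightarrow> (x \<in> B \<longleftrightarrow> y \<in> B))"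

lemma window_set_mono: "window_set X N B \<Longrightarrow> N \<le> N' \<Longrightarrow> window_set X N' B"
  unfolding window_set_def agree_def by (meson order_trans)

lemma window_set_UN:
  "finite I \<Longrightarrow> (\<And>i. i \<in> I \<Longrightarrow> window_set X N (B i)) \<Longrightarrow> window_set X N (\<Union>i\<in>I. B i)"
  unfolding window_set_def by (intro conjI ballI impI sets.finite_UN) (blast+)

text \<open>Shifting forward by \<open>N\<close> makes the two-sided window one-sided: around time
  \<open>i + N\<close> it covers times \<open>i, ..., i + 2 * N\<close>, all below
  \<open>n + 2 * N\<close>.\<close>

lemma agree_shift:
  assumes "x \<in> space M" "y \<in> space M" "itin T X (n + 2 * N) x = itin T X (n + 2 * N) y" "i < n"
  shows "agree X N ((T ^^ (i + N)) x) ((T ^^ (i + N)) y)"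
proof -
  have eq: "X ((T ^^ j) x) = X ((T ^^ j) y)" if "j \<le> i + 2 * N" for j
    using assms(3,4) that by (auto simp: itin_eq_iff)
  show ?thesis
    unfolding agree_def
  proof (intro allI impI conjI)
    fix k assume k: "k \<le> N"
    have "(T ^^ k) ((T ^^ (i + N)) z) = (T ^^ (k + (i + N))) z" for z
      by (simp add: funpow_add)
    thus "X ((T ^^ k) ((T ^^ (i + N)) x)) = X ((T ^^ k) ((T ^^ (i + N)) y))"
      using k by (simp only:) (intro eq, simp)
    have "(S ^^ k) ((T ^^ (i + N)) z) = (T ^^ (i + N - k)) z" if "z \<in> space M" for z
      using S_funpow_T_funpow[OF that, of k "i + N - k"] k by simp
    thus "X ((S ^^ k) ((T ^^ (i + N)) x)) = X ((S ^^ k) ((T ^^ (i + N)) y))"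
      using assms(1,2) by (simp only:) (intro eq, simp)
  qed
qed

section \<open>Approximation of measurable sets by finite windows\<close>

definition approximable :: "('a \<Rightarrow> 'b) \<Rightarrow> 'a set \<Rightarrow> bool" where
  "approximable X A \<longleftrightarrow> A \<in> sets M \<and>
     (\<forall>d>0. \<exists>N B. window_set X N B \<and> measure M (sym_diff A B) < d)"

lemma approximable_window_set: "window_set X N B \<Longrightarrow> approximable X B"
  unfolding approximable_def by (auto simp: window_set_def intro!: exI[of _ N] exI[of _ B])

lemma approximable_Compl:
  assumes "approximable X A"
  shows "approximable X (space M - A)"
  unfolding approximable_def
proof (intro conjI allI impI)
  show "space M - A \<in> sets M" using assms by (auto simp: approximable_def)
  fix d :: real assume "0 < d"
  then obtain N B where B: "window_set X N B" "measure M (sym_diff A B) < d"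
    using assms unfolding approximable_def by blast
  have "A \<subseteq> space M" "B \<subseteq> space M"
    using assms B(1) by (auto simp: approximable_def window_set_def dest: sets.sets_into_space)
  hence "sym_diff (space M - A) (space M - B) = sym_diff A B" by blast
  moreover have "window_set X N (space M - B)" using B(1) by (auto simp: window_set_def)
  ultimately show "\<exists>N B. window_set X N B \<and> measure M (sym_diff (space M - A) B) < d"
    using B(2) by metis
qed

text \<open>Half of \<open>d\<close> pays for cutting the union off at a finite stage, the other
  half for approximating the finitely many remaining sets.\<close>

lemma approximable_UN:
  fixes A :: "nat \<Rightarrow> 'a set"
  assumes A: "\<And>i. approximable X (A i)"
  shows "approximable X (\<Union>i. A i)"
  unfolding approximable_def
proof (intro conjI allI impI)
  have [measurable]: "A i \<in> sets M" for i using A by (auto simp: approximable_def)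
  show "(\<Union>i. A i) \<in> sets M" by measurable
  fix d :: real assume d: "0 < d"
  have "(\<lambda>n. measure M (\<Union>i<n. A i)) \<longlonglongrightarrow> measure M (\<Union>n. \<Union>i<n. A i)"
    by (rule finite_Lim_measure_incseq) (auto simp: incseq_def intro: less_le_trans)
  also have "(\<Union>n. \<Union>i<n. A i) = (\<Union>i. A i)" by auto
  finally have "\<forall>\<^sub>F n in sequentially. measure M (\<Union>i. A i) - d / 2 < measure M (\<Union>i<n. A i)"
    using d by (intro order_tendstoD(1)) auto
  then obtain n where n: "measure M (\<Union>i. A i) - d / 2 < measure M (\<Union>i<n. A i)"
    by (auto simp: eventually_sequentially)
  \<comment> \<open>The denominator has \<open>n + 1\<close> instead of \<open>n\<close> so that
    \<open>n = 0\<close> is covered.\<close>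
  have "\<exists>N B. window_set X N B \<and> measure M (sym_diff (A i) B) < d / (2 * (real n + 1))" for i
    using A[of i] d unfolding approximable_def by auto
  then obtain N B where B: "\<And>i. window_set X (N i) (B i)"
    "\<And>i. measure M (sym_diff (A i) (B i)) < d / (2 * (real n + 1))"
    by metis
  have [measurable]: "B i \<in> sets M" for i using B(1) by (auto simp: window_set_def)
  \<comment> \<open>The sum of the window sizes serves as a common bound for them.\<close>
  have "window_set X (\<Sum>i<n. N i) (\<Union>i<n. B i)"
    by (intro window_set_UN window_set_mono[OF B(1)] member_le_sum) auto
  moreover have "measure M (sym_diff (\<Union>i. A i) (\<Union>i<n. B i)) < d"
  proof -
    have "measure M (sym_diff (\<Union>i. A i) (\<Union>i<n. B i))
        \<le> measure M (((\<Union>i. A i) - (\<Union>i<n. A i)) \<union> (\<Union>i<n. sym_diff (A i) (B i)))"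
      by (rule finite_measure_mono) (blast, measurable)
    also have "\<dots> \<le> measure M ((\<Union>i. A i) - (\<Union>i<n. A i)) + measure M (\<Union>i<n. sym_diff (A i) (B i))"
      by (rule measure_Un_le) measurable
    also have "measure M ((\<Union>i. A i) - (\<Union>i<n. A i)) = measure M (\<Union>i. A i) - measure M (\<Union>i<n. A i)"
      by (rule finite_measure_Diff) auto
    also have "measure M (\<Union>i<n. sym_diff (A i) (B i)) \<le> (\<Sum>i<n. measure M (sym_diff (A i) (B i)))"
      by (rule finite_measure_subadditive_finite) auto
    also have "\<dots> \<le> (\<Sum>i<n. d / (2 * (real n + 1)))"
      using B(2) by (intro sum_mono less_imp_le)
    also have "\<dots> \<le> d / 2" using d by (simp add: field_simps)
    finally show ?thesis using n by simp
  qed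
  ultimately show "\<exists>N Ba. window_set X N Ba \<and> measure M (sym_diff (\<Union>i. A i) Ba) < d"
    by blast
qed

text \<open>Orbit sets depend on a finite window, and approximability survives complements and
  countable unions, so it holds on the generated sigma-algebra; the generator property adds a null
  set.\<close>

lemma approximable_generator:
  fixes X :: "'a \<Rightarrow> 'b::countable"
  assumes X [measurable]: "rv M X" and gen: "generator M T (fibers M X)" and A: "A \<in> sets M"
  shows "approximable X A"
proof -
  have orb: "approximable X D" if D: "D \<in> orbit_sets M T (fibers M X)" for D
  proof -
    obtain k R C where DR: "D = (R ^^ k) -` C \<inter> space M" "R = T \<or> R = S" "C \<in> fibers M X"
      using D unfolding orbit_sets_def S_def[symmetric] by blast
    then obtain v where v: "C = X -` {v} \<inter> space M" unfolding fibers_def by auto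
    have R [measurable]: "(R ^^ k) \<in> M \<rightarrow>\<^sub>M M" using DR by auto
    have "D \<in> sets M" unfolding DR(1) v by measurable
    moreover have "x \<in> D \<longleftrightarrow> X ((R ^^ k) x) = v" if "x \<in> space M" for x
      using that measurable_space[OF R] unfolding DR(1) v by auto
    ultimately have "window_set X k D"
      using DR(2) unfolding window_set_def agree_def by auto
    thus ?thesis by (rule approximable_window_set)
  qed
  have approx: "approximable X B" if "B \<in> sigma_sets (space M) (orbit_sets M T (fibers M X))" for B
    using that
  proof (induction rule: sigma_sets.induct)
    case Empty
    have "window_set X 0 {}" by (simp add: window_set_def)
    thus ?case by (rule approximable_window_set)
  qed (auto intro: orb approximable_Compl approximable_UN)
  obtain B where B: "B \<in> sigma_sets (space M) (orbit_sets M T (fibers M X))"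
    and null: "emeasure M (sym_diff A B) = 0"
    using gen A unfolding generator_def by blast
  have Bm: "B \<in> sets M" using approx[OF B] by (simp add: approximable_def)
  show ?thesis
    unfolding approximable_def
  proof (intro conjI allI impI A)
    fix d :: real assume "0 < d"
    then obtain N C where C: "window_set X N C" "measure M (sym_diff B C) < d"
      using approx[OF B] unfolding approximable_def by blast
    have Cm: "C \<in> sets M" using C by (simp add: window_set_def)
    have "measure M (sym_diff A C) \<le> measure M (sym_diff A B \<union> sym_diff B C)"
      using A Bm Cm by (intro finite_measure_mono) auto
    also have "\<dots> \<le> measure M (sym_diff A B) + measure M (sym_diff B C)"
      using A Bm Cm by (intro measure_Un_le) auto
    also have "\<dots> < d" using null C(2) by (simp add: measure_def)
    finally show "\<exists>N B. window_set X N B \<and> measure M (sym_diff A B) < d"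
      using C(1) by blast
  qed
qed

lemma obtain_window_approximation:
  fixes X :: "'a \<Rightarrow> 'b::countable" and W :: "'a \<Rightarrow> nat"
  assumes X [measurable]: "rv M X" and gen: "generator M T (fibers M X)"
    and W [measurable]: "rv M W" and K: "\<forall>x\<in>space M. W x < K" and e: "0 < e"
  obtains N and W' :: "'a \<Rightarrow> nat" where "rv M W'"
    "\<And>x y. x \<in> space M \<Longrightarrow> y \<in> space M \<Longrightarrow> agree X N x y \<Longrightarrow> W' x = W' y"
    "measure M {x \<in> space M. W x \<noteq> W' x} < e"
proof -
  define A where "A j = {x \<in> space M. W x = j}" for j
  have A [measurable]: "A j \<in> sets M" for j unfolding A_def by measurable
  have "\<exists>N B. window_set X N B \<and> measure M (sym_diff (A j) B) < e / (real K + 1)" for j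
    using approximable_generator[OF X gen A[of j]] e unfolding approximable_def by auto
  then obtain N B where B: "\<And>j. window_set X (N j) (B j)"
    "\<And>j. measure M (sym_diff (A j) (B j)) < e / (real K + 1)"
    by metis
  have [measurable]: "B j \<in> sets M" for j using B(1) by (auto simp: window_set_def)
  define N' where "N' = (\<Sum>j<K. N j)"
  \<comment> \<open>Where no \<open>B j\<close> contains \<open>x\<close> the value is unspecified,
    but it still depends on the window only, and such \<open>x\<close> lies in the error set of
    index \<open>W x\<close>.\<close>
  define W' where "W' x = (LEAST j. j < K \<and> x \<in> B j)" for x
  have win: "window_set X N' (B j)" if "j < K" for j
    unfolding N'_def using that by (intro window_set_mono[OF B(1)] member_le_sum) auto
  have W' [measurable]: "rv M W'" unfolding W'_def by measurable
  show thesis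
  proof (rule that[of W' N'])
    show "W' x = W' y" if "x \<in> space M" "y \<in> space M" "agree X N' x y" for x y
    proof -
      have "(j < K \<and> x \<in> B j) = (j < K \<and> y \<in> B j)" for j
        using win[of j] that unfolding window_set_def by blast
      thus ?thesis by (simp add: W'_def)
    qed
    have "measure M {x \<in> space M. W x \<noteq> W' x} \<le> measure M (\<Union>j<K. sym_diff (A j) (B j))"
    proof (rule finite_measure_mono)
      show "{x \<in> space M. W x \<noteq> W' x} \<subseteq> (\<Union>j<K. sym_diff (A j) (B j))"
      proof (rule ccontr)
        assume "\<not> ?thesis"
        then obtain x where x: "x \<in> space M" "W x \<noteq> W' x" "\<And>j. j < K \<Longrightarrow> x \<notin> sym_diff (A j) (B j)"
          by blast
        have "x \<in> B j \<longleftrightarrow> j = W x" if "j < K" for j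
          using x(3)[OF that] x(1) unfolding A_def by blast
        with K x(1) have "(j < K \<and> x \<in> B j) = (j = W x)" for j
          by metis
        moreover have "(LEAST j. j = W x) = W x" by (rule Least_equality) auto
        ultimately show False using x(2) by (simp add: W'_def)
      qed
    qed measurable
    also have "\<dots> \<le> (\<Sum>j<K. measure M (sym_diff (A j) (B j)))"
      by (rule finite_measure_subadditive_finite) auto
    also have "\<dots> \<le> (\<Sum>j<K. e / (real K + 1))"
      using B(2) by (intro sum_mono less_imp_le)
    also have "\<dots> < e" using e by (simp add: field_simps)
    finally show "measure M {x \<in> space M. W x \<noteq> W' x} < e" .
  qed fact
qed

text \<open>Upper half of the Kolmogorov-Sinai theorem. \<open>W\<close> agrees with a window
  function \<open>W'\<close> off a small set; itineraries of \<open>W'\<close> cost those of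
  \<open>X\<close> with \<open>2 * N\<close> extra letters, and the exceptions cost at most
  \<open>e\<close> per step.\<close>

lemma ent_rate_le_generator:
  fixes X :: "'a \<Rightarrow> 'b::countable" and W :: "'a \<Rightarrow> nat"
  assumes X [measurable]: "rv M X" and gen: "generator M T (fibers M X)" and fin: "ent M X < \<infinity>"
    and W [measurable]: "rv M W" and fW: "finite (W ` space M)" and m: "0 < m"
  shows "ent_rate M T (fibers M W) \<le> enn2real (ent M (itin T X m)) / real m"
proof (rule field_le_epsilon)
  fix e :: real assume e: "0 < e"
  obtain K where K: "\<forall>x\<in>space M. W x < K"
    using fW by (metis finite_nat_set_iff_bounded imageI)
  \<comment> \<open>With error measure below \<open>t\<^sup>2\<close> the finite bound gives entropy
    at most \<open>(2 * K + 1) * t\<close>, hence at most \<open>e\<close>; the minimum with 1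
    ensures \<open>t\<^sup>2 \<le> 1\<close>.\<close>
  define t where "t = min 1 (e / (2 * real K + 1))"
  have t: "0 < t" "t \<le> 1" using e by (auto simp: t_def)
  have "(2 * real K + 1) * t \<le> (2 * real K + 1) * (e / (2 * real K + 1))"
    by (intro mult_left_mono) (auto simp: t_def)
  also have "\<dots> = e" by (simp add: add_nonneg_eq_0_iff)
  finally have t_e: "(2 * real K + 1) * t \<le> e" .
  have t2: "0 < t\<^sup>2" using t by simp
  obtain N W' where W' [measurable]: "rv M W'"
    and agr: "\<And>x y. x \<in> space M \<Longrightarrow> y \<in> space M \<Longrightarrow> agree X N x y \<Longrightarrow> W' x = W' y"
    and meas: "measure M {x \<in> space M. W x \<noteq> W' x} < t\<^sup>2"
    by (rule obtain_window_approximation[OF X gen W K t2]) (rule that)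
  \<comment> \<open>\<open>Suc\<close> reserves 0 for agreement, so that \<open>W\<close> can be
    read off from \<open>W'\<close> and \<open>Z\<close>.\<close>
  define Z where "Z x = (if W x = W' x then 0 else Suc (W x))" for x
  have Z [measurable]: "rv M Z"
    unfolding Z_def by (rule rv_compose2[OF W W', where f = "\<lambda>w w'. if w = w' then 0 else Suc w"])
  have entZ: "ent M Z \<le> ennreal e"
  proof -
    have "1 - pmf (law M Z) 0 = measure M (space M - (Z -` {0} \<inter> space M))"
      unfolding pmf_law[OF Z] by (subst prob_compl) auto
    also have "space M - (Z -` {0} \<inter> space M) = {x \<in> space M. W x \<noteq> W' x}"
      by (auto simp: Z_def)
    finally have "1 - pmf (law M Z) 0 \<le> t\<^sup>2" using meas by simp
    hence "ent M Z \<le> ennreal ((2 * card (Suc ` {..<K}) + 1) * sqrt (t\<^sup>2))"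
      using set_pmf_law[OF Z] K t
      by (intro pmf_entropy_finite_le[where z = 0]) (auto simp: Z_def power_le_one split: if_splits)
    also have "\<dots> \<le> ennreal e"
      using t t_e by (intro ennreal_leI) (simp add: card_image add.commute)
    finally show ?thesis .
  qed
  define a where "a n = enn2real (ent M (itin T X n))" for n
  have entX: "ent M (itin T X n) = ennreal (a n)" for n
    using ent_itin_finite[OF X fin, of n] by (simp add: a_def)
  have a0: "0 \<le> a n" for n by (simp add: a_def)
  define C where "C = (\<Sum>s<m. a s)"
  \<comment> \<open>The extra letters and the remainder of the division by \<open>m\<close> cost a
    constant, which disappears as \<open>n\<close> grows.\<close>
  have "enn2real (ent M (itin T W n)) / real n \<le> a m / real m + e + (2 * real N / m * a m + C) / real n"
    if n: "0 < n" for n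
  proof -
    have "ent M (itin T W n) \<le> ent M (itin T W' n) + of_nat n * ent M Z"
      by (rule ent_itin_function_le[where g = "\<lambda>w z. if z = 0 then w else z - 1"])
         (auto simp: Z_def Z[unfolded Z_def])
    \<comment> \<open>Stationarity permits a shift by \<open>N\<close>, after which the windows
      reach no negative times.\<close>
    also have "ent M (itin T W' n) = ent M (\<lambda>x. itin T W' n ((T ^^ N) x))"
      by (subst law_shift) measurable
    also have "\<dots> \<le> ent M (itin T X (n + 2 * N))"
    proof (rule ent_mono)
      fix x y assume *: "x \<in> space M" "y \<in> space M" "itin T X (n + 2 * N) x = itin T X (n + 2 * N) y"
      have "W' ((T ^^ (i + N)) x) = W' ((T ^^ (i + N)) y)" if "i < n" for i
        using agr agree_shift[OF * that] * by (simp add: T_funpow_space)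
      thus "itin T W' n ((T ^^ N) x) = itin T W' n ((T ^^ N) y)"
        by (simp add: itin_eq_iff funpow_add)
    qed measurable
    also have "\<dots> \<le> ennreal ((real (n + 2 * N) / real m) * a m + C)"
      unfolding entX C_def
    proof (intro ennreal_leI subadditive_le_linear m a0)
      show "a (i + j) \<le> a i + a j" for i j
        using ent_itin_add[OF X, of i j] a0 by (simp add: entX flip: ennreal_plus)
    qed
    also have "of_nat n * ent M Z \<le> ennreal (real n * e)"
      using mult_left_mono[OF entZ, of "of_nat n"] e
      by (simp add: ennreal_mult' ennreal_of_nat_eq_real_of_nat)
    finally have "ent M (itin T W n) \<le> ennreal ((real (n + 2 * N) / real m) * a m + C + real n * e)"
      using e a0 by (simp add: C_def sum_nonneg flip: ennreal_plus)
    hence "enn2real (ent M (itin T W n)) \<le> (real (n + 2 * N) / real m) * a m + C + real n * e"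
      using e a0 by (intro enn2real_leI) (auto simp: C_def intro!: sum_nonneg add_nonneg_nonneg)
    hence "enn2real (ent M (itin T W n)) / real n
        \<le> ((real (n + 2 * N) / real m) * a m + C + real n * e) / real n"
      by (rule divide_right_mono) simp
    also have "\<dots> = a m / real m + e + (2 * real N / m * a m + C) / real n"
      using n m by (simp add: field_simps)
    finally show ?thesis .
  qed
  moreover have "(\<lambda>n. a m / real m + e + (2 * real N / m * a m + C) / real n) \<longlonglongrightarrow> a m / real m + e + 0"
    by (intro tendsto_intros lim_const_over_n)
  ultimately have "ent_rate M T (fibers M W) \<le> a m / real m + e + 0"
    using ent_rate_fibers[OF W ent_finite_range[OF W fW]]
    by (intro LIMSEQ_le) (auto intro!: exI[of _ 1])
  thus "ent_rate M T (fibers M W) \<le> enn2real (ent M (itin T X m)) / real m + e"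
    by (simp add: a_def)
qed

lemma KS_entropy_le_generator:
  fixes X :: "'a \<Rightarrow> 'b::countable"
  assumes "rv M X" "generator M T (fibers M X)" "ent M X < \<infinity>" "0 < m"
  shows "KS_entropy M T \<le> ennreal (enn2real (ent M (itin T X m)) / real m)"
  unfolding KS_entropy_def
proof (intro SUP_least ennreal_leI)
  fix \<eta> assume "\<eta> \<in> {\<eta>. meas_partition M \<eta> \<and> finite \<eta>}"
  hence \<eta>: "meas_partition M \<eta>" "finite \<eta>" by auto
  obtain W :: "'a \<Rightarrow> nat" where W: "rv M W" "fibers M W = \<eta>"
    using meas_partition_obtain_fibers[OF \<eta>(1)] .
  show "ent_rate M T \<eta> \<le> enn2real (ent M (itin T X m)) / real m"
    using ent_rate_le_generator[OF assms(1-3) W(1) _ assms(4)] W(2) \<eta>(2)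
    by (simp flip: finite_fibers_iff)
qed

end

section \<open>Passage to the limit along the invariant measures\<close>

lemma stationary_automorphism_invariant_prob:
  assumes "automorphism M T" "invariant_prob M T \<mu>"
  shows "stationary_automorphism \<mu> T"
proof -
  have \<mu>: "prob_space \<mu>" "sets \<mu> = sets M"
    and inv: "\<And>A. A \<in> sets M \<Longrightarrow> emeasure \<mu> (T -` A \<inter> space M) = emeasure \<mu> A"
    using assms(2) by (auto simp: invariant_prob_def)
  have sp: "space \<mu> = space M" by (rule sets_eq_imp_space_eq) fact
  have aut: "automorphism \<mu> T"
    using assms(1) unfolding automorphism_def measurable_cong_sets[OF \<mu>(2) \<mu>(2)] sp .
  hence T: "T \<in> \<mu> \<rightarrow>\<^sub>M \<mu>" by (simp add: automorphism_def)
  have "distr \<mu> \<mu> T = \<mu>"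
    by (rule measure_eqI) (use inv in \<open>auto simp: emeasure_distr[OF T] \<mu>(2) sp\<close>)
  with T aut \<mu>(1) show ?thesis
    by (simp add: stationary_automorphism_def stationary_def stationary_axioms_def
        stationary_automorphism_axioms_def)
qed

theorem mainTheorem1:
  fixes M :: "'a measure" and T :: "'a \<Rightarrow> 'a" and \<mu> :: "nat \<Rightarrow> 'a measure"
    and \<xi> :: "'a set set" and r :: "nat \<Rightarrow> nat" and \<epsilon> :: "nat \<Rightarrow> real" and h :: real
  assumes "automorphism M T"
    and "\<And>n. invariant_prob M T (\<mu> n)"
    and "meas_partition M \<xi>"
    and "part_entropy (\<mu> 0) \<xi> < \<infinity>"
    and "filterlim r at_top sequentially"
    and "\<And>n. \<epsilon> n > 0"
    and "\<epsilon> \<longlonglongrightarrow> 0"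
    and "h \<ge> 0"
    and "limsup (\<lambda>n. KS_entropy (\<mu> n) T) \<ge> ennreal h"
    and "\<And>n. generator (\<mu> n) T \<xi>"
    and "\<And>n A. A \<in> dyn_refine M T \<xi> (r n + 1) \<Longrightarrow>
           \<bar>measure (\<mu> 0) A - measure (\<mu> n) A\<bar> \<le> \<epsilon> n * measure (\<mu> n) A"
  shows "KS_entropy (\<mu> 0) T \<ge> ennreal h"
proof -
  obtain X :: "'a \<Rightarrow> nat" where X: "rv M X" and \<xi>: "fibers M X = \<xi>"
    using meas_partition_obtain_fibers[OF assms(3)] .
  have sets: "sets (\<mu> n) = sets M" for n
    using assms(2)[of n] by (simp add: invariant_prob_def)
  have space: "space (\<mu> n) = space M" for n by (rule sets_eq_imp_space_eq) fact
  have stat: "stationary_automorphism (\<mu> n) T" for n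
    by (rule stationary_automorphism_invariant_prob) fact+
  interpret \<mu>: stationary_automorphism "\<mu> n" T for n by (rule stat)
  have X\<mu>: "rv (\<mu> n) X" for n
    using X by (simp add: measurable_cong_sets[OF sets refl])
  have \<xi>\<mu>: "fibers (\<mu> n) X = \<xi>" for n using \<xi> by (simp add: fibers_def space)
  have TM: "T \<in> space M \<rightarrow> space M"
    using assms(1) by (auto simp: automorphism_def dest: measurable_space)
  define q where "q n k = law (\<mu> n) (itin T X k)" for n k
  \<comment> \<open>Atoms of a short refinement are unions of atoms of a long one; on laws this is
    the marginal under \<open>take\<close>.\<close>
  have q_map: "map_pmf (take k) (q n j) = q n k" if "k \<le> j" for n k j
    unfolding q_def using that by (simp add: \<mu>.map_pmf_law[OF \<mu>.rv_itin[OF X\<mu>]] take_itin)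
  \<comment> \<open>The length is \<open>r n + 1\<close> because the times run from 0 to
    \<open>r n\<close> inclusive. Words that never occur are not atoms, but have mass 0 under both
    laws.\<close>
  have close: "\<bar>pmf (q 0 (r n + 1)) w - pmf (q n (r n + 1)) w\<bar> \<le> \<epsilon> n * pmf (q n (r n + 1)) w" for n w
  proof (cases "w \<in> itin T X (r n + 1) ` space M")
    case True
    hence "itin T X (r n + 1) -` {w} \<inter> space M \<in> dyn_refine M T \<xi> (r n + 1)"
      unfolding \<xi>[symmetric] dyn_refine_fibers[OF TM] by (auto simp: fibers_def)
    from assms(11)[OF this] show ?thesis
      unfolding q_def \<mu>.pmf_law[OF \<mu>.rv_itin[OF X\<mu>]] space .
  next
    case False
    hence "itin T X (r n + 1) -` {w} \<inter> space M = {}" by auto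
    thus ?thesis unfolding q_def \<mu>.pmf_law[OF \<mu>.rv_itin[OF X\<mu>]] space by simp
  qed
  \<comment> \<open>The error bound puts the mass under \<open>\<mu> 0\<close> between
    \<open>1 - \<epsilon> n\<close> and \<open>1 + \<epsilon> n\<close> times that under
    \<open>\<mu> n\<close>, whence the two constants.\<close>
  have upper: "pmf_entropy (q n m) \<le> ennreal (1 / (1 - \<epsilon> n)) * (pmf_entropy (q 0 m) + ennreal (ln (1 + \<epsilon> n)))"
    if n: "\<epsilon> n < 1" "m \<le> r n + 1" for n m
  proof (rule pmf_entropy_perturb)
    have 1: "pmf (q n (r n + 1)) w \<le> 1 / (1 - \<epsilon> n) * pmf (q 0 (r n + 1)) w" for w
      using close[of n w] n by (simp add: field_simps abs_le_iff)
    have 2: "pmf (q 0 (r n + 1)) w \<le> (1 + \<epsilon> n) * pmf (q n (r n + 1)) w" for w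
      using close[of n w] by (simp add: field_simps abs_le_iff)
    show "pmf (q n m) x \<le> 1 / (1 - \<epsilon> n) * pmf (q 0 m) x"
      "pmf (q 0 m) x \<le> (1 + \<epsilon> n) * pmf (q n m) x" for x
      unfolding q_map[OF n(2), symmetric] using n assms(6)[of n]
      by (intro pmf_map_le 1 2; simp)+
  qed (use n assms(6)[of n] in auto)
  have ent0: "ent (\<mu> 0) X < \<infinity>"
    using assms(4) by (simp flip: \<mu>.part_entropy_fibers[OF X\<mu>] add: \<xi>\<mu>)
  have "h \<le> enn2real (ent (\<mu> 0) (itin T X m)) / real m" if m: "0 < m" for m
  proof -
    define b where "b = enn2real (pmf_entropy (q 0 m))"
    have b: "pmf_entropy (q 0 m) = ennreal b" "0 \<le> b"
      using \<mu>.ent_itin_finite[OF X\<mu> ent0, of m] by (auto simp: b_def q_def)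
    let ?u = "\<lambda>n. 1 / (1 - \<epsilon> n) * (b + ln (1 + \<epsilon> n)) / real m"
    have "\<forall>\<^sub>F n in sequentially. KS_entropy (\<mu> n) T \<le> ennreal (?u n)"
    proof -
      have "\<forall>\<^sub>F n in sequentially. \<epsilon> n < 1" using assms(7) by (rule order_tendstoD) simp
      moreover have "\<forall>\<^sub>F n in sequentially. m \<le> r n"
        using assms(5) by (simp add: filterlim_at_top)
      ultimately show ?thesis
      proof eventually_elim
        case (elim n)
        have "pmf_entropy (q n m) \<le> ennreal (1 / (1 - \<epsilon> n) * (b + ln (1 + \<epsilon> n)))"
          using upper[of n m] elim b assms(6)[of n]
          by (simp flip: ennreal_plus ennreal_mult')
        hence le: "ent (\<mu> n) (itin T X m) \<le> ennreal (1 / (1 - \<epsilon> n) * (b + ln (1 + \<epsilon> n)))"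
          by (simp add: q_def)
        \<comment> \<open>Finite entropy of \<open>\<xi>\<close> is assumed for
          \<open>\<mu> 0\<close> only. For \<open>\<mu> n\<close> it follows from the bound just
          obtained, \<open>X\<close> being the first letter of an itinerary of length
          \<open>m > 0\<close>.\<close>
        have "ent (\<mu> n) X \<le> ent (\<mu> n) (itin T X m)"
          by (rule \<mu>.ent_mono[OF \<mu>.rv_itin[OF X\<mu>]]) (use m in \<open>auto simp: itin_eq_iff\<close>)
        also note le
        finally have "ent (\<mu> n) X < \<infinity>" by (rule le_less_trans) simp
        hence "KS_entropy (\<mu> n) T \<le> ennreal (enn2real (ent (\<mu> n) (itin T X m)) / real m)"
          using assms(10)[of n] m by (intro \<mu>.KS_entropy_le_generator X\<mu>) (simp_all add: \<xi>\<mu>)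
        also have "\<dots> \<le> ennreal (?u n)"
          using le elim b assms(6)[of n]
          by (intro ennreal_leI divide_right_mono enn2real_leI) auto
        finally show ?case .
      qed
    qed
    hence "limsup (\<lambda>n. KS_entropy (\<mu> n) T) \<le> limsup (\<lambda>n. ennreal (?u n))"
      by (rule Limsup_mono)
    also have "?u \<longlonglongrightarrow> 1 / (1 - 0) * (b + ln (1 + 0)) / real m"
      by (intro tendsto_intros assms(7)) (use m in auto)
    hence "(\<lambda>n. ennreal (?u n)) \<longlonglongrightarrow> ennreal (b / real m)"
      by (intro tendsto_ennrealI) simp
    hence "limsup (\<lambda>n. ennreal (?u n)) = ennreal (b / real m)"
      by (intro lim_imp_Limsup) auto
    finally have "ennreal h \<le> ennreal (b / real m)"
      using assms(9) by (rule order_trans[rotated])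
    thus ?thesis using b by (simp add: b_def q_def)
  qed
  thus ?thesis by (intro \<mu>.ent_itin_rate_le_KS_entropy[OF X\<mu> ent0])
qed

end
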